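(* Let $G$ be a connected graph of order $n\ge 2$, and let $k$ be a positive integer. Then (up to isomorphism of graphs): (a) $\gamma_L^k(G)=1$ if and only if $G\in\bigcup_{i=2}^{k+1}\{P_i\}$; (b) $\gamma_L^1(G)=n-1$ if and only if $G\in\{K_n,K_{1,n-1}\}$; (c) for $k\ge 2$, $\gamma_L^k(G)=n-1$ if and only if $G=K_n$.
   Context: All graphs are finite, simple, undirected and connected. $P_i$ is the path on $i$ vertices, $K_n$ the complete graph on $n$ vertices, and $K_{1,n-1}$ the complete bipartite graph with parts of sizes $1$ and $n-1$. $d(x,y)$ is the length of a shortest path between $x$ and $y$ in $G$. For a positive integer $k$, let $d_k(x,y)=\min\{d(x,y),k+1\}$. A set $D\subseteq V(G)$ is a distance-$k$ dominating set of $G$ if for each $u\in V(G)\setminus D$ there is $w\in D$ with $d(u,w)\le k$. A set $S\subseteq V(G)$ is a distance-$k$ resolving set of $G$ if for any distinct $x,y\in V(G)$ there is $z\in S$ with $d_k(x,z)\ne d_k(y,z)$. A distance-$k$ locating-dominating set of $G$ is a set $S\subseteq V(G)$ that is both a distance-$k$ dominating set and a distance-$k$ resolving set of $G$; the distance-$k$ location-domination number $\gamma_L^k(G)$ is the minimum cardinality of such a set. *)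

theory Defs
  imports "Graph_Theory.Graph_Theory"
begin

text \<open>
  Finite simple undirected graphs are the locale \<^locale>\<open>graph\<close>: finite, loop-free symmetric
  digraphs without parallel arcs, each undirected edge being a pair of opposite arcs.
\<close>

text \<open>
  The length of a shortest path. The arc list of a path has one entry per edge.
  The value is unspecified if there is no path between the two vertices, which cannot
  happen for vertices of a connected graph.
\<close>
definition gdist :: "('a, 'b) pre_digraph \<Rightarrow> 'a \<Rightarrow> 'a \<Rightarrow> nat" where
  "gdist G x y = (LEAST l. \<exists>p. pre_digraph.apath G x p y \<and> length p = l)"

definition gdist_trunc :: "('a, 'b) pre_digraph \<Rightarrow> nat \<Rightarrow> 'a \<Rightarrow> 'a \<Rightarrow> nat" where
  "gdist_trunc G k x y = min (gdist G x y) (k + 1)"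

definition dist_dominating :: "('a, 'b) pre_digraph \<Rightarrow> nat \<Rightarrow> 'a set \<Rightarrow> bool" where
  "dist_dominating G k D \<longleftrightarrow>
     D \<subseteq> verts G \<and> (\<forall>u \<in> verts G - D. \<exists>w \<in> D. gdist G u w \<le> k)"

definition dist_resolving :: "('a, 'b) pre_digraph \<Rightarrow> nat \<Rightarrow> 'a set \<Rightarrow> bool" where
  "dist_resolving G k S \<longleftrightarrow>
     S \<subseteq> verts G \<and>
     (\<forall>x \<in> verts G. \<forall>y \<in> verts G. x \<noteq> y \<longrightarrow>
        (\<exists>z \<in> S. gdist_trunc G k x z \<noteq> gdist_trunc G k y z))"

definition dist_locating_dominating :: "('a, 'b) pre_digraph \<Rightarrow> nat \<Rightarrow> 'a set \<Rightarrow> bool" where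
  "dist_locating_dominating G k S \<longleftrightarrow> dist_dominating G k S \<and> dist_resolving G k S"

text \<open>The minimum exists for finite \<open>G\<close>, since \<open>verts G\<close> itself is such a set.\<close>
definition location_domination_number :: "nat \<Rightarrow> ('a, 'b) pre_digraph \<Rightarrow> nat" where
  "location_domination_number k G =
     (LEAST m. \<exists>S. dist_locating_dominating G k S \<and> card S = m)"

text \<open>The path on \<open>i\<close> vertices \<open>0, \<dots>, i - 1\<close>.\<close>
definition path_graph :: "nat \<Rightarrow> nat pair_pre_digraph" where
  "path_graph i =
     \<lparr> pverts = {0..<i},
       parcs = {(u, v). u < i \<and> v < i \<and> (v = Suc u \<or> u = Suc v)} \<rparr>"

end

theory Submission
  imports Defs
begin

text \<open>
  Supersets of locating-dominating sets are locating-dominating, and the complement of a single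
  vertex is always such a set. So the number is \<open>n - 1\<close> exactly if no complement of two
  vertices is locating-dominating. If \<open>x\<close>, \<open>y\<close>, \<open>z\<close> is an induced path of a graph that is not
  complete, then \<open>x\<close> separates \<open>y\<close> from \<open>z\<close>, and it dominates both for \<open>k \<ge> 2\<close>. For \<open>k = 1\<close>,
  the pairs \<open>x, y\<close> and \<open>y, z\<close> can only fail if \<open>x\<close> and \<open>z\<close> are leaves at \<open>y\<close>; the same argument
  makes every other neighbour of \<open>y\<close> a leaf, so that the graph is a star.
  If \<open>{s}\<close> is locating-dominating, then the distance to \<open>s\<close> is injective and bounded by \<open>k\<close>; its
  range is an initial segment, and adjacent vertices have consecutive distances, which numbers the
  vertices as on a path.
\<close>

section \<open>Distances\<close>

text \<open>Cutting a closed subwalk out of a walk only shortens it. Distances, defined through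
  paths, can thus be bounded by arbitrary walks, without checking for repeated vertices.\<close>

lemma (in wf_digraph) awalk_shorten:
  assumes "awalk u p v"
  shows "\<exists>q. apath u q v \<and> length q \<le> length p"
  using assms
proof (induct rule: awalk_to_apath_induct)
  case (path p)
  then show ?case by (auto simp: apath_def)
next
  case (decomp p q r s)
  have "p = q @ r @ s"
    using decomp(2,1,3) by (rule awalk_cyc_decompE)
  with decomp(4) show ?case by fastforce
qed

lemma (in wf_digraph) gdist_le_awalk:
  assumes "awalk u p v"
  shows "gdist G u v \<le> length p"
proof -
  obtain q where "apath u q v" "length q \<le> length p"
    using awalk_shorten[OF assms] by blast
  then have "gdist G u v \<le> length q"
    unfolding gdist_def by (intro Least_le) blast
  with \<open>length q \<le> length p\<close> show ?thesis by simp
qed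

locale connected_graph = graph +
  assumes connected: "connected G"
begin

abbreviation "V \<equiv> verts G"

lemma adj_sym: "u \<rightarrow> v \<Longrightarrow> v \<rightarrow> u"
  by (rule arcs_ends_symmetric[OF sym_arcs])

lemma ex_shortest_awalk:
  assumes "u \<in> V" "v \<in> V"
  obtains p where "awalk u p v" "length p = gdist G u v"
proof -
  have "u \<rightarrow>\<^sup>* v"
    using symmetric_connected_imp_strongly_connected[OF sym_arcs connected] assms
    by (auto simp: strongly_connected_def)
  then have "\<exists>l p. apath u p v \<and> length p = l" by (simp add: reachable_apath)
  then have "\<exists>p. apath u p v \<and> length p = gdist G u v"
    unfolding gdist_def by (rule LeastI_ex)
  then show ?thesis using that by (auto dest: awalkI_apath)
qed

lemma gdist_eq_0_iff:
  assumes "u \<in> V" "v \<in> V"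
  shows "gdist G u v = 0 \<longleftrightarrow> u = v"
proof
  assume "gdist G u v = 0"
  then show "u = v" using ex_shortest_awalk[OF assms] by (auto simp: awalk_Nil_iff)
next
  assume "u = v"
  then show "gdist G u v = 0" using gdist_le_awalk[of u "[]" v] assms by (simp add: awalk_Nil_iff)
qed

lemma gdist_adj_le:
  assumes "u \<rightarrow> v" "w \<in> V"
  shows "gdist G u w \<le> Suc (gdist G v w)"
proof -
  obtain e where e: "e \<in> arcs G" "tail G e = u" "head G e = v" using assms(1) by auto
  obtain p where p: "awalk v p w" "length p = gdist G v w"
    using ex_shortest_awalk[OF adj_in_verts(2)[OF assms(1)] assms(2)] .
  have "awalk u (e # p) w" using e p by (simp add: awalk_Cons_iff)
  from gdist_le_awalk[OF this] p show ?thesis by simp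
qed

text \<open>The witness is the second vertex of a shortest walk. The rest of that walk bounds its
  distance from above, and \<open>gdist_adj_le\<close> bounds it from below.\<close>

lemma gdist_stepE:
  assumes "u \<in> V" "w \<in> V" "gdist G u w = Suc d"
  obtains v where "u \<rightarrow> v" "v \<in> V" "gdist G v w = d"
proof -
  obtain p where "awalk u p w" "length p = Suc d"
    using ex_shortest_awalk assms by metis
  then obtain e es where p: "e \<in> arcs G" "u = tail G e" "awalk (head G e) es w" "length es = d"
    by (cases p) (auto simp: awalk_Cons_iff)
  have adj: "u \<rightarrow> head G e" using p by (auto dest: in_arcs_imp_in_arcs_ends)
  have "gdist G (head G e) w \<le> d" using gdist_le_awalk[OF p(3)] p(4) by simp
  moreover have "Suc d \<le> Suc (gdist G (head G e) w)"
    using gdist_adj_le[OF adj assms(2)] assms(3) by simp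
  ultimately show ?thesis using that[OF adj] adj_in_verts[OF adj] by simp
qed

lemma gdist_eq_1_iff:
  assumes "u \<in> V" "v \<in> V"
  shows "gdist G u v = Suc 0 \<longleftrightarrow> u \<rightarrow> v"
proof
  assume "gdist G u v = Suc 0"
  then show "u \<rightarrow> v"
    using gdist_stepE[OF assms] gdist_eq_0_iff assms by metis
next
  assume adj: "u \<rightarrow> v"
  then have "u \<noteq> v" using adj_not_same by blast
  then have "gdist G u v \<noteq> 0" using gdist_eq_0_iff assms by simp
  then show "gdist G u v = Suc 0"
    using gdist_adj_le[OF adj assms(2)] gdist_eq_0_iff[OF assms(2,2)] by simp
qed

lemma gdist_le_1_iff:
  assumes "u \<in> V" "v \<in> V"
  shows "gdist G u v \<le> Suc 0 \<longleftrightarrow> u = v \<or> u \<rightarrow> v"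
  using gdist_eq_0_iff[OF assms] gdist_eq_1_iff[OF assms] by linarith

lemma ex_adj:
  assumes "v \<in> V" "card V \<ge> 2"
  obtains w where "v \<rightarrow> w"
proof -
  have "V \<noteq> {v}" using assms(2) by auto
  then obtain w where w: "w \<in> V" "w \<noteq> v" using assms(1) by blast
  then obtain d where "gdist G v w = Suc d"
    using gdist_eq_0_iff[OF assms(1) w(1)] by (cases "gdist G v w") auto
  then show ?thesis using gdist_stepE assms(1) w(1) that by metis
qed

text \<open>The witnesses are the first three vertices of a shortest path from \<open>u\<close> to
  \<open>v\<close>. The distance to \<open>v\<close> drops by one at each step, so the first and the
  third vertex are neither equal nor adjacent.\<close>

lemma not_complete_induced_pathE:
  assumes "u \<in> V" "v \<in> V" "u \<noteq> v" "\<not> u \<rightarrow> v"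
  obtains x y z where "x \<rightarrow> y" "y \<rightarrow> z" "x \<noteq> z" "\<not> x \<rightarrow> z" "gdist G z x = 2"
proof -
  have "\<not> gdist G u v \<le> Suc 0" using gdist_le_1_iff assms by simp
  then obtain d where d: "gdist G u v = Suc (Suc d)"
    by (metis Suc_leI not_less_eq_eq le0 not0_implies_Suc)
  obtain w where w: "u \<rightarrow> w" "w \<in> V" "gdist G w v = Suc d"
    using gdist_stepE[OF assms(1,2) d] by blast
  obtain z where z: "w \<rightarrow> z" "z \<in> V" "gdist G z v = d"
    using gdist_stepE[OF w(2) assms(2) w(3)] by blast
  have "u \<noteq> z" using d z(3) by auto
  moreover have nadj: "\<not> u \<rightarrow> z" using gdist_adj_le[of u z v] assms(2) d z(3) by auto
  moreover have "gdist G z u = 2"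
  proof -
    have "gdist G z u \<le> Suc (gdist G w u)"
      using gdist_adj_le[OF adj_sym[OF z(1)] assms(1)] .
    moreover have "gdist G w u = Suc 0"
      using gdist_eq_1_iff[OF w(2) assms(1)] adj_sym[OF w(1)] by blast
    moreover have "\<not> gdist G z u \<le> Suc 0"
      using gdist_le_1_iff[OF z(2) assms(1)] \<open>u \<noteq> z\<close> nadj adj_sym by blast
    ultimately show ?thesis by simp
  qed
  ultimately show ?thesis using that w(1) z(1) by blast
qed


section \<open>Locating-dominating sets\<close>

lemma gdist_trunc_self: "z \<in> V \<Longrightarrow> gdist_trunc G k z z = 0"
  using gdist_eq_0_iff[of z z] by (simp add: gdist_trunc_def)

lemma gdist_trunc_neq_self:
  assumes "x \<in> V" "z \<in> V" "x \<noteq> z"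
  shows "gdist_trunc G k x z \<noteq> gdist_trunc G k z z"
  using gdist_eq_0_iff[OF assms(1,2)] assms by (simp add: gdist_trunc_self) (simp add: gdist_trunc_def)

lemma gdist_trunc_1:
  assumes "x \<in> V" "z \<in> V"
  shows "gdist_trunc G 1 x z = (if x = z then 0 else if x \<rightarrow> z then 1 else 2)"
  using gdist_eq_0_iff[OF assms] gdist_eq_1_iff[OF assms] by (auto simp: gdist_trunc_def)

lemma dist_locating_dominating_mono:
  assumes "dist_locating_dominating G k S" "S \<subseteq> T" "T \<subseteq> V"
  shows "dist_locating_dominating G k T"
  using assms
  unfolding dist_locating_dominating_def dist_dominating_def dist_resolving_def by blast

text \<open>Any neighbour of \<open>v\<close> dominates it, and of two distinct vertices at least
  one stays in the set and is the only vertex at distance 0 from itself.\<close>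

lemma dist_locating_dominating_Diff1:
  assumes "v \<in> V" "card V \<ge> 2" "k \<ge> 1"
  shows "dist_locating_dominating G k (V - {v})"
proof -
  obtain w where w: "v \<rightarrow> w" using ex_adj assms by blast
  then have "w \<in> V - {v}" using adj_in_verts adj_not_same by blast
  moreover have "gdist G v w \<le> k"
    using gdist_eq_1_iff[of v w] w adj_in_verts[OF w] assms(3) by simp
  ultimately have "dist_dominating G k (V - {v})"
    unfolding dist_dominating_def by blast
  moreover have "dist_resolving G k (V - {v})"
    unfolding dist_resolving_def
  proof (intro conjI ballI impI)
    fix x y assume "x \<in> V" "y \<in> V" "x \<noteq> y"
    then show "\<exists>z\<in>V - {v}. gdist_trunc G k x z \<noteq> gdist_trunc G k y z"
      using gdist_trunc_neq_self by (metis Diff_iff singletonD)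
  qed blast
  ultimately show ?thesis by (simp add: dist_locating_dominating_def)
qed

text \<open>Only the pair \<open>x\<close>, \<open>y\<close> has to be examined: every other pair
  contains a vertex of the set, which separates itself from its partner.\<close>

lemma dist_locating_dominating_Diff2_iff:
  assumes "x \<in> V" "y \<in> V" "x \<noteq> y"
  shows "dist_locating_dominating G k (V - {x, y}) \<longleftrightarrow>
    (\<exists>a \<in> V - {x, y}. gdist G x a \<le> k) \<and> (\<exists>b \<in> V - {x, y}. gdist G y b \<le> k) \<and>
    (\<exists>w \<in> V - {x, y}. gdist_trunc G k x w \<noteq> gdist_trunc G k y w)"
    (is "_ \<longleftrightarrow> ?a \<and> ?b \<and> ?c")
proof -
  have "V - (V - {x, y}) = {x, y}" using assms by blast
  then have "dist_dominating G k (V - {x, y}) \<longleftrightarrow> ?a \<and> ?b"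
    by (simp add: dist_dominating_def)
  moreover have "dist_resolving G k (V - {x, y}) \<longleftrightarrow> ?c"
  proof
    assume "dist_resolving G k (V - {x, y})"
    then show ?c using assms unfolding dist_resolving_def by blast
  next
    assume c: ?c
    show "dist_resolving G k (V - {x, y})"
      unfolding dist_resolving_def
    proof (intro conjI ballI impI)
      fix u v assume uv: "u \<in> V" "v \<in> V" "u \<noteq> v"
      show "\<exists>z\<in>V - {x, y}. gdist_trunc G k u z \<noteq> gdist_trunc G k v z"
      proof (cases "u \<in> {x, y} \<and> v \<in> {x, y}")
        case True
        with uv c show ?thesis by force
      next
        case False
        then show ?thesis using uv gdist_trunc_neq_self by (metis Diff_iff)
      qed
    qed blast
  qed
  ultimately show ?thesis by (simp add: dist_locating_dominating_def)
qed

lemma location_domination_number_le: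
  "dist_locating_dominating G k S \<Longrightarrow> location_domination_number k G \<le> card S"
  unfolding location_domination_number_def by (rule Least_le) blast

lemma minimum_locating_dominatingE:
  assumes "card V \<ge> 2" "k \<ge> 1"
  obtains S where "dist_locating_dominating G k S" "card S = location_domination_number k G"
proof -
  have "V \<noteq> {}" using assms(1) by auto
  then have "\<exists>m S. dist_locating_dominating G k S \<and> card S = m"
    using dist_locating_dominating_Diff1 assms by blast
  then have "\<exists>S. dist_locating_dominating G k S \<and> card S = location_domination_number k G"
    unfolding location_domination_number_def by (rule LeastI_ex)
  then show ?thesis using that by blast
qed

section \<open>The value \<open>n - 1\<close> and complete graphs\<close>

lemma location_domination_number_eq_pred_iff:
  assumes "card V \<ge> 2" "k \<ge> 1"
  shows "location_domination_number k G = card V - 1 \<longleftrightarrow>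
    (\<forall>x \<in> V. \<forall>y \<in> V. x \<noteq> y \<longrightarrow> \<not> dist_locating_dominating G k (V - {x, y}))"
proof
  assume eq: "location_domination_number k G = card V - 1"
  show "\<forall>x \<in> V. \<forall>y \<in> V. x \<noteq> y \<longrightarrow> \<not> dist_locating_dominating G k (V - {x, y})"
  proof (intro ballI impI notI)
    fix x y assume xy: "x \<in> V" "y \<in> V" "x \<noteq> y" "dist_locating_dominating G k (V - {x, y})"
    have "card (V - {x, y}) = card V - 2" using xy by (simp add: card_Diff_subset)
    then show False using location_domination_number_le[OF xy(4)] eq assms(1) by simp
  qed
next
  assume no: "\<forall>x \<in> V. \<forall>y \<in> V. x \<noteq> y \<longrightarrow> \<not> dist_locating_dominating G k (V - {x, y})"
  obtain S where S: "dist_locating_dominating G k S" "card S = location_domination_number k G"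
    using minimum_locating_dominatingE assms by blast
  have SV: "S \<subseteq> V" using S(1) by (simp add: dist_locating_dominating_def dist_dominating_def)
  obtain v where v: "v \<in> V" using assms(1) by fastforce
  have "location_domination_number k G \<le> card V - 1"
    using location_domination_number_le[OF dist_locating_dominating_Diff1[OF v assms]] v by simp
  \<comment> \<open>Two distinct vertices \<open>x\<close>, \<open>y\<close> outside
    \<open>S\<close> would make \<open>V - {x, y}\<close> a superset of \<open>S\<close>, hence
    locating-dominating, against \<open>no\<close>.\<close>
  moreover have "card (V - S) \<le> 1"
  proof -
    have "x = y" if "x \<in> V - S" "y \<in> V - S" for x y
      using that no dist_locating_dominating_mono[OF S(1), of "V - {x, y}"] SV by blast
    then show ?thesis by (metis card_le_Suc0_iff_eq finite_Diff finite_verts One_nat_def)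
  qed
  then have "card V - 1 \<le> card S"
    using card_Diff_subset[OF finite_subset[OF SV finite_verts] SV] by simp
  ultimately show "location_domination_number k G = card V - 1" using S(2) by simp
qed

lemma complete_digraph_iff:
  "complete_digraph (card V) G \<longleftrightarrow> (\<forall>x \<in> V. \<forall>y \<in> V. x \<noteq> y \<longrightarrow> x \<rightarrow> y)"
proof -
  have "arcs_ends G \<subseteq> {(u, v). (u, v) \<in> V \<times> V \<and> u \<noteq> v}"
    using adj_in_verts adj_not_same by auto
  then show ?thesis using graph_axioms unfolding complete_digraph_def by blast
qed

text \<open>All vertices other than \<open>x\<close> and \<open>y\<close> are at distance one from
  both, so none of them tells \<open>x\<close> from \<open>y\<close>.\<close>

lemma complete_imp_location_domination_number:
  assumes "card V \<ge> 2" "k \<ge> 1" "complete_digraph (card V) G"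
  shows "location_domination_number k G = card V - 1"
  unfolding location_domination_number_eq_pred_iff[OF assms(1,2)]
proof (intro ballI impI)
  fix x y assume xy: "x \<in> V" "y \<in> V" "x \<noteq> y"
  have "gdist_trunc G k x w = gdist_trunc G k y w" if "w \<in> V - {x, y}" for w
  proof -
    have "x \<rightarrow> w" "y \<rightarrow> w" using assms(3) xy that unfolding complete_digraph_iff by auto
    then show ?thesis
      using xy that gdist_eq_1_iff[of x w] gdist_eq_1_iff[of y w] by (simp add: gdist_trunc_def)
  qed
  then show "\<not> dist_locating_dominating G k (V - {x, y})"
    unfolding dist_locating_dominating_Diff2_iff[OF xy] by blast
qed

lemma location_domination_number_imp_complete:
  assumes "card V \<ge> 2" "k \<ge> 2" "location_domination_number k G = card V - 1"
  shows "complete_digraph (card V) G"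
  unfolding complete_digraph_iff
proof (intro ballI impI, rule ccontr)
  fix u v assume "u \<in> V" "v \<in> V" "u \<noteq> v" "\<not> u \<rightarrow> v"
  then obtain x y z where
    xyz: "x \<rightarrow> y" "y \<rightarrow> z" "x \<noteq> z" "\<not> x \<rightarrow> z" "gdist G z x = 2"
    by (rule not_complete_induced_pathE)
  have V: "x \<in> V" "y \<in> V" "z \<in> V" using xyz adj_in_verts by auto
  have neq: "x \<noteq> y" "y \<noteq> z" using xyz adj_not_same by auto
  have "gdist G y x = Suc 0" using gdist_eq_1_iff[OF V(2,1)] xyz(1) adj_sym by blast
  \<comment> \<open>The hypothesis \<open>k \<ge> 2\<close> makes \<open>x\<close> dominate
    \<open>z\<close>, and truncation at \<open>k + 1\<close> leaves the distances 1 and 2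
    unchanged.\<close>
  then have "gdist G y x \<le> k" "gdist G z x \<le> k" "gdist_trunc G k y x \<noteq> gdist_trunc G k z x"
    using assms(2) xyz(5) by (auto simp: gdist_trunc_def)
  then have "dist_locating_dominating G k (V - {y, z})"
    unfolding dist_locating_dominating_Diff2_iff[OF V(2,3) neq(2)] using V neq xyz(3) by blast
  moreover have "k \<ge> 1" using assms(2) by simp
  ultimately show False
    using assms(3) V neq unfolding location_domination_number_eq_pred_iff[OF assms(1) \<open>k \<ge> 1\<close>]
    by blast
qed


section \<open>Stars\<close>

text \<open>The centre \<open>c\<close> is the sole element of the part of size one. On two vertices
  either of them can serve as centre.\<close>

lemma complete_bipartite_1_iff:
  assumes "card V \<ge> 2"
  shows "complete_bipartite_digraph 1 (card V - 1) G \<longleftrightarrow>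
    (\<exists>c \<in> V. \<forall>x \<in> V. \<forall>y \<in> V. x \<rightarrow> y \<longleftrightarrow> x \<noteq> y \<and> (x = c \<or> y = c))"
proof
  assume "complete_bipartite_digraph 1 (card V - 1) G"
  then obtain U W where UW: "V = U \<union> W" "U \<inter> W = {}" "card U = 1"
    "arcs_ends G = U \<times> W \<union> W \<times> U"
    unfolding complete_bipartite_digraph_def by blast
  then obtain c where "U = {c}" by (auto simp: card_1_singleton_iff)
  then have "c \<in> V" "W = V - {c}" using UW(1,2) by auto
  then show "\<exists>c \<in> V. \<forall>x \<in> V. \<forall>y \<in> V. x \<rightarrow> y \<longleftrightarrow> x \<noteq> y \<and> (x = c \<or> y = c)"
    using UW(4) \<open>U = {c}\<close> by (intro bexI[of _ c]) auto
next
  assume "\<exists>c \<in> V. \<forall>x \<in> V. \<forall>y \<in> V. x \<rightarrow> y \<longleftrightarrow> x \<noteq> y \<and> (x = c \<or> y = c)"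
  then obtain c where c: "c \<in> V" "\<forall>x \<in> V. \<forall>y \<in> V. x \<rightarrow> y \<longleftrightarrow> x \<noteq> y \<and> (x = c \<or> y = c)" by blast
  have "x \<rightarrow> y \<longleftrightarrow> x \<in> V \<and> y \<in> V \<and> x \<noteq> y \<and> (x = c \<or> y = c)" for x y
    using c(2) adj_in_verts[of x y] by blast
  then have "arcs_ends G = {c} \<times> (V - {c}) \<union> (V - {c}) \<times> {c}"
    using c(1) by auto
  moreover have "V = {c} \<union> (V - {c})" "{c} \<inter> (V - {c}) = {}" "card {c} = 1"
    "card (V - {c}) = card V - 1" using c(1) by auto
  ultimately show "complete_bipartite_digraph 1 (card V - 1) G"
    using graph_axioms unfolding complete_bipartite_digraph_def
    by (intro conjI exI[of _ "{c}"] exI[of _ "V - {c}"])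
qed

text \<open>If one of two omitted vertices is the centre, the other is a leaf left without a
  dominating neighbour. If both are leaves, they have the same distance to every other
  vertex.\<close>

lemma star_imp_location_domination_number:
  assumes "card V \<ge> 2" "complete_bipartite_digraph 1 (card V - 1) G"
  shows "location_domination_number 1 G = card V - 1"
  unfolding location_domination_number_eq_pred_iff[OF assms(1) order_refl]
proof (intro ballI impI notI)
  obtain c where c: "c \<in> V" "\<forall>x \<in> V. \<forall>y \<in> V. x \<rightarrow> y \<longleftrightarrow> x \<noteq> y \<and> (x = c \<or> y = c)"
    using assms(2) unfolding complete_bipartite_1_iff[OF assms(1)] by blast
  fix x y assume xy: "x \<in> V" "y \<in> V" "x \<noteq> y" "dist_locating_dominating G 1 (V - {x, y})"
  then obtain a b w where abw: "a \<in> V - {x, y}" "gdist G x a \<le> Suc 0"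
    "b \<in> V - {x, y}" "gdist G y b \<le> Suc 0"
    "w \<in> V - {x, y}" "gdist_trunc G 1 x w \<noteq> gdist_trunc G 1 y w"
    unfolding dist_locating_dominating_Diff2_iff[OF xy(1-3)] One_nat_def by blast
  have "x \<rightarrow> a" "y \<rightarrow> b" using abw xy gdist_le_1_iff by auto
  then have "x \<noteq> c" "y \<noteq> c" using c abw(1,3) xy by auto
  then have "gdist_trunc G 1 x w = gdist_trunc G 1 y w"
    using abw(5) c xy gdist_trunc_1[of x w] gdist_trunc_1[of y w] by auto
  then show False using abw(6) by simp
qed

lemma location_domination_number_imp_complete_or_star:
  assumes "card V \<ge> 2" "location_domination_number 1 G = card V - 1"
  shows "complete_digraph (card V) G \<or> complete_bipartite_digraph 1 (card V - 1) G"
proof (rule disjCI)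
  assume not_star: "\<not> complete_bipartite_digraph 1 (card V - 1) G"
  \<comment> \<open>A second neighbour \<open>u\<close> of \<open>x\<close> would dominate
    \<open>x\<close>, while \<open>z\<close> dominates \<open>y\<close> and separates it from
    \<open>x\<close>; then \<open>V - {x, y}\<close> would be locating-dominating.\<close>
  have leaf: "u = y" if "x \<rightarrow> y" "y \<rightarrow> z" "z \<noteq> x" "\<not> x \<rightarrow> z" "x \<rightarrow> u" for x y z u
  proof (rule ccontr)
    assume "u \<noteq> y"
    have V: "x \<in> V" "y \<in> V" "z \<in> V" "u \<in> V" using that adj_in_verts by auto
    have neq: "x \<noteq> y" "z \<noteq> y" "u \<noteq> x" using that adj_not_same by auto
    have "gdist G x u \<le> 1" "gdist G y z \<le> 1" using gdist_le_1_iff V that by auto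
    moreover have "gdist_trunc G 1 x z \<noteq> gdist_trunc G 1 y z"
      using V that neq unfolding gdist_trunc_1[OF V(1,3)] gdist_trunc_1[OF V(2,3)] by auto
    ultimately have "dist_locating_dominating G 1 (V - {x, y})"
      unfolding dist_locating_dominating_Diff2_iff[OF V(1,2) neq(1)]
      using V neq \<open>u \<noteq> y\<close> that(3) by blast
    then show False
      using assms(2) V neq
      unfolding location_domination_number_eq_pred_iff[OF assms(1) order_refl] by blast
  qed
  show "complete_digraph (card V) G"
    unfolding complete_digraph_iff
  proof (intro ballI impI, rule ccontr)
    fix u v assume "u \<in> V" "v \<in> V" "u \<noteq> v" "\<not> u \<rightarrow> v"
    then obtain x c z where xcz: "x \<rightarrow> c" "c \<rightarrow> z" "x \<noteq> z" "\<not> x \<rightarrow> z"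
      by (rule not_complete_induced_pathE)
    have c: "c \<in> V" using xcz adj_in_verts by blast
    have x_leaf: "u = c" if "x \<rightarrow> u" for u using leaf xcz that by metis
    \<comment> \<open>A neighbour \<open>w\<close> of \<open>c\<close> other than \<open>x\<close>
      is not adjacent to \<open>x\<close>, whose only neighbour is \<open>c\<close>. So
      \<open>w\<close>, \<open>c\<close>, \<open>x\<close> is again an induced path, and
      \<open>leaf\<close> applies to it.\<close>
    have leaves: "u = c" if "w \<rightarrow> c" "w \<rightarrow> u" for w u
    proof (cases "w = x")
      case True
      then show ?thesis using x_leaf that by blast
    next
      case False
      moreover have "w \<noteq> c" using that adj_not_same by blast
      ultimately have "\<not> w \<rightarrow> x" using x_leaf adj_sym by blast
      then show ?thesis using leaf[OF that(1) adj_sym[OF xcz(1)] _ _ that(2)] False by blast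
    qed
    \<comment> \<open>Along a walk from \<open>c\<close>, each step leads from \<open>c\<close> to
      one of its neighbours or from such a leaf back to \<open>c\<close>.\<close>
    have near: "w = c \<or> w \<rightarrow> c" if "w \<in> V" for w
    proof -
      have "c \<rightarrow>\<^sup>* w" using ex_shortest_awalk[OF c that] reachable_awalk by metis
      then show ?thesis
        by (induct rule: reachable_induct) (use leaves adj_sym in blast)+
    qed
    have "\<forall>x \<in> V. \<forall>y \<in> V. x \<rightarrow> y \<longleftrightarrow> x \<noteq> y \<and> (x = c \<or> y = c)"
      using near leaves adj_sym adj_not_same by metis
    then show False using not_star c unfolding complete_bipartite_1_iff[OF assms(1)] by blast
  qed
qed

end


section \<open>Paths\<close>

text \<open>An isomorphism also has to map arcs. Without parallel arcs in \<open>G\<close>, and with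
  vertex pairs as the arcs of the target, the vertex map determines the arc map.\<close>

lemma (in nomulti_digraph) digraph_iso_with_proj_iff:
  assumes "parcs H \<subseteq> pverts H \<times> pverts H"
  shows "digraph_iso G (with_proj H) \<longleftrightarrow>
    (\<exists>f. bij_betw f (verts G) (pverts H) \<and>
      (\<forall>u \<in> verts G. \<forall>v \<in> verts G. u \<rightarrow> v \<longleftrightarrow> (f u, f v) \<in> parcs H))"
proof
  assume "digraph_iso G (with_proj H)"
  then obtain h where h: "digraph_isomorphism h" "with_proj H = app_iso h G"
    by (auto simp: digraph_iso_def)
  have inj: "inj_on (iso_verts h) (verts G)" using h(1) by (rule digraph_isomorphism_inj_on_verts)
  have "verts (with_proj H) = verts (app_iso h G)"
    "arcs_ends (with_proj H) = arcs_ends (app_iso h G)" using h(2) by simp_all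
  then have vH: "pverts H = iso_verts h ` verts G"
    and aH: "parcs H = (\<lambda>(u, v). (iso_verts h u, iso_verts h v)) ` arcs_ends G"
    by (simp_all add: arcs_ends_app_iso_eq[OF h(1)])
  have "u \<rightarrow> v \<longleftrightarrow> (iso_verts h u, iso_verts h v) \<in> parcs H" if "u \<in> verts G" "v \<in> verts G" for u v
    using that inj unfolding aH by (auto dest: inj_onD adj_in_verts)
  then show "\<exists>f. bij_betw f (verts G) (pverts H) \<and>
      (\<forall>u \<in> verts G. \<forall>v \<in> verts G. u \<rightarrow> v \<longleftrightarrow> (f u, f v) \<in> parcs H)"
    using inj vH unfolding bij_betw_def by blast
next
  assume "\<exists>f. bij_betw f (verts G) (pverts H) \<and>
      (\<forall>u \<in> verts G. \<forall>v \<in> verts G. u \<rightarrow> v \<longleftrightarrow> (f u, f v) \<in> parcs H)"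
  then obtain f where f: "inj_on f (verts G)" "f ` verts G = pverts H"
    "\<And>u v. u \<in> verts G \<Longrightarrow> v \<in> verts G \<Longrightarrow> u \<rightarrow> v \<longleftrightarrow> (f u, f v) \<in> parcs H"
    by (auto simp: bij_betw_def)
  \<comment> \<open>An arc goes to the pair of the images of its ends; \<open>fst\<close> and
    \<open>snd\<close> are the tail and head maps of \<open>with_proj H\<close>.\<close>
  define h where "h = \<lparr>iso_verts = f, iso_arcs = (\<lambda>a. (f (tail G a), f (head G a))),
    iso_head = snd, iso_tail = fst\<rparr>"
  have "inj_on (\<lambda>a. (f (tail G a), f (head G a))) (arcs G)"
    by (rule inj_onI, rule no_multi_arcs) (auto simp: arc_to_ends_def dest: inj_onD[OF f(1)])
  then have "digraph_isomorphism h"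
    using f(1) wf_digraph by (auto simp: digraph_isomorphism_def h_def)
  moreover have "(\<lambda>a. (f (tail G a), f (head G a))) ` arcs G = parcs H"
  proof (intro equalityI subsetI)
    fix p assume "p \<in> (\<lambda>a. (f (tail G a), f (head G a))) ` arcs G"
    then obtain a where "a \<in> arcs G" "p = (f (tail G a), f (head G a))" by blast
    then show "p \<in> parcs H"
      using f(3)[of "tail G a" "head G a"] in_arcs_imp_in_arcs_ends[of a] by simp
  next
    fix p assume p: "p \<in> parcs H"
    then obtain u v where uv: "u \<in> verts G" "v \<in> verts G" "p = (f u, f v)"
      using assms f(2) by blast
    then have "u \<rightarrow> v" using f(3) p by blast
    then show "p \<in> (\<lambda>a. (f (tail G a), f (head G a))) ` arcs G" using uv(3) by auto
  qed
  then have "with_proj H = app_iso h G"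
    by (simp add: app_iso_def h_def with_proj_def f(2))
  ultimately show "digraph_iso G (with_proj H)" by (auto simp: digraph_iso_def)
qed

lemma (in nomulti_digraph) digraph_iso_path_graph_iff:
  "digraph_iso G (with_proj (path_graph i)) \<longleftrightarrow>
    (\<exists>f. bij_betw f (verts G) {0..<i} \<and>
      (\<forall>u \<in> verts G. \<forall>v \<in> verts G. u \<rightarrow> v \<longleftrightarrow> f v = Suc (f u) \<or> f u = Suc (f v)))"
proof -
  have "parcs (path_graph i) \<subseteq> pverts (path_graph i) \<times> pverts (path_graph i)"
    by (auto simp: path_graph_def)
  note digraph_iso_with_proj_iff[OF this]
  \<comment> \<open>The bounds by \<open>i\<close> in \<open>path_graph\<close> hold automatically,
    since \<open>f\<close> takes its values in \<open>{0..<i}\<close>.\<close>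
  moreover have "(f u, f v) \<in> parcs (path_graph i) \<longleftrightarrow> f v = Suc (f u) \<or> f u = Suc (f v)"
    if "bij_betw f (verts G) {0..<i}" "u \<in> verts G" "v \<in> verts G" for f u v
    using that(2,3) bij_betwE[OF that(1)] by (auto simp: path_graph_def)
  ultimately show ?thesis by (simp add: path_graph_def cong: conj_cong)
qed

section \<open>The value 1 and paths\<close>

context connected_graph
begin

lemma location_domination_number_eq_1_iff:
  assumes "card V \<ge> 2" "k \<ge> 1"
  shows "location_domination_number k G = 1 \<longleftrightarrow> (\<exists>s. dist_locating_dominating G k {s})"
proof
  assume "location_domination_number k G = 1"
  then obtain S where "dist_locating_dominating G k S" "card S = 1"
    using minimum_locating_dominatingE[OF assms] by metis
  then show "\<exists>s. dist_locating_dominating G k {s}" by (auto simp: card_1_singleton_iff)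
next
  assume "\<exists>s. dist_locating_dominating G k {s}"
  then have "location_domination_number k G \<le> 1"
    using location_domination_number_le by fastforce
  moreover obtain S where S: "dist_locating_dominating G k S"
    "card S = location_domination_number k G"
    using minimum_locating_dominatingE[OF assms] .
  have "S \<subseteq> V" using S(1) by (simp add: dist_locating_dominating_def dist_dominating_def)
  then have "finite S" using finite_subset finite_verts by blast
  \<comment> \<open>The value 0 is excluded because the empty set dominates no vertex.\<close>
  moreover have "V \<noteq> {}" using assms(1) by auto
  then have "S \<noteq> {}"
    using S(1) by (auto simp: dist_locating_dominating_def dist_dominating_def)
  ultimately show "location_domination_number k G = 1"
    using S(2) by (metis One_nat_def card_0_eq le_antisym not_less_eq_eq le_zero_eq)
qed

text \<open>Along a shortest path to \<open>s\<close> the distance falls by exactly one per step, so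
  it skips no value.\<close>

lemma gdist_range_downward_closed:
  assumes "u \<in> V" "s \<in> V" "j \<le> gdist G u s"
  shows "\<exists>v \<in> V. gdist G v s = j"
  using assms
proof (induct "gdist G u s" arbitrary: u)
  case 0
  then show ?case by auto
next
  case (Suc d)
  then obtain v where "v \<in> V" "gdist G v s = d" using gdist_stepE by metis
  with Suc show ?case by (metis le_Suc_eq)
qed

text \<open>Domination by \<open>s\<close> bounds all distances to \<open>s\<close> by
  \<open>k\<close>, so truncation at \<open>k + 1\<close> has no effect and resolving becomes
  injectivity.\<close>

lemma dist_locating_dominating_singleton_iff:
  "dist_locating_dominating G k {s} \<longleftrightarrow>
    s \<in> V \<and> (\<forall>u \<in> V. gdist G u s \<le> k) \<and> inj_on (\<lambda>u. gdist G u s) V"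
proof (cases "s \<in> V \<and> (\<forall>u \<in> V. gdist G u s \<le> k)")
  case True
  then have "gdist_trunc G k u s = gdist G u s" if "u \<in> V" for u
    using that by (fastforce simp: gdist_trunc_def)
  with True show ?thesis
    unfolding dist_locating_dominating_def dist_dominating_def dist_resolving_def inj_on_def by auto
next
  case False
  \<comment> \<open>Domination constrains only the vertices other than \<open>s\<close>; the bound
    at \<open>s\<close> itself comes from distance 0.\<close>
  have "gdist G s s = 0" if "s \<in> V" using that gdist_eq_0_iff by blast
  then have "\<not> dist_dominating G k {s}"
    using False unfolding dist_dominating_def by (metis DiffI insert_subset le0 singletonD)
  with False show ?thesis unfolding dist_locating_dominating_def by blast
qed

lemma singleton_locating_dominating_imp_path:
  assumes "dist_locating_dominating G k {s}"
  shows "card V \<le> k + 1" "digraph_iso G (with_proj (path_graph (card V)))"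
proof -
  let ?d = "\<lambda>u. gdist G u s"
  have s: "s \<in> V" and le: "\<forall>u \<in> V. ?d u \<le> k" and inj: "inj_on ?d V"
    using assms by (auto simp: dist_locating_dominating_singleton_iff)
  \<comment> \<open>Let \<open>m\<close> be a vertex farthest from \<open>s\<close>. The range of
    the distance is the whole segment from 0 to \<open>?d m\<close>, so injectivity gives
    \<open>card V = Suc (?d m)\<close>.\<close>
  have "Max (?d ` V) \<in> ?d ` V" using s by (intro Max_in) auto
  then obtain m where m: "m \<in> V" "Max (?d ` V) = ?d m" by blast
  then have "?d u \<le> ?d m" if "u \<in> V" for u
    using that Max_ge[of "?d ` V" "?d u"] by simp
  then have "?d ` V = {0..<Suc (?d m)}"
    using gdist_range_downward_closed[OF m(1) s] by (fastforce simp: image_iff less_Suc_eq_le)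
  moreover from this have card: "card V = Suc (?d m)" using card_image[OF inj] by simp
  ultimately have bij: "bij_betw ?d V {0..<card V}" using inj by (simp add: bij_betw_def)
  show "card V \<le> k + 1" using card le m(1) by simp
  have "u \<rightarrow> v \<longleftrightarrow> ?d v = Suc (?d u) \<or> ?d u = Suc (?d v)" if uv: "u \<in> V" "v \<in> V" for u v
  proof
    assume adj: "u \<rightarrow> v"
    \<comment> \<open>Adjacent vertices have distances differing by at most one, and injectivity
      rules out equality.\<close>
    then have "?d u \<noteq> ?d v" using inj_onD[OF inj _ uv] adj_not_same by blast
    then show "?d v = Suc (?d u) \<or> ?d u = Suc (?d v)"
      using gdist_adj_le[OF adj s] gdist_adj_le[OF adj_sym[OF adj] s] by linarith
  next
    \<comment> \<open>Some neighbour of \<open>a\<close> is one step closer to \<open>s\<close>; it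
      has the same distance as \<open>b\<close>, so by injectivity it is \<open>b\<close>.\<close>
    have step: "a \<rightarrow> b" if "a \<in> V" "b \<in> V" "?d a = Suc (?d b)" for a b
      using gdist_stepE[OF that(1) s that(3)] inj_onD[OF inj] that(2) by metis
    assume "?d v = Suc (?d u) \<or> ?d u = Suc (?d v)"
    then show "u \<rightarrow> v" using step uv adj_sym by blast
  qed
  with bij show "digraph_iso G (with_proj (path_graph (card V)))"
    unfolding digraph_iso_path_graph_iff by blast
qed

text \<open>Take for \<open>s\<close> the end of the path numbered 0. The numbering \<open>f\<close>
  is then the distance to \<open>s\<close>, so it is injective and at most \<open>i - 1\<close>,
  hence at most \<open>k\<close>.\<close>

lemma path_imp_singleton_locating_dominating:
  assumes "digraph_iso G (with_proj (path_graph i))" "1 \<le> i" "i \<le> k + 1"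
  shows "\<exists>s. dist_locating_dominating G k {s}"
proof -
  obtain f where f: "bij_betw f V {0..<i}"
    "\<And>u v. u \<in> V \<Longrightarrow> v \<in> V \<Longrightarrow> u \<rightarrow> v \<longleftrightarrow> f v = Suc (f u) \<or> f u = Suc (f v)"
    using assms(1) unfolding digraph_iso_path_graph_iff by blast
  have img: "f ` V = {0..<i}" using f(1) by (simp add: bij_betw_def)
  then have "0 \<in> f ` V" using assms(2) by simp
  then obtain s where s: "s \<in> V" "f s = 0" by auto
  \<comment> \<open>One step changes the number by one, so reaching 0 from \<open>u\<close> takes at
    least \<open>f u\<close> steps.\<close>
  have ge: "f u \<le> gdist G u s" if "u \<in> V" for u
    using that
  proof (induct "gdist G u s" arbitrary: u)
    case 0
    then show ?case using gdist_eq_0_iff[OF 0(2) s(1)] s(2) by simp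
  next
    case (Suc d)
    then obtain v where "u \<rightarrow> v" "v \<in> V" "gdist G v s = d" using gdist_stepE s(1) by metis
    with Suc f(2)[of u v] show ?case by fastforce
  qed
  \<comment> \<open>Conversely, descending through the numbers one by one reaches \<open>s\<close>
    in \<open>f u\<close> steps.\<close>
  have le: "gdist G u s \<le> f u" if "u \<in> V" for u
    using that
  proof (induct "f u" arbitrary: u)
    case 0
    then have "u = s" using inj_onD[OF bij_betw_imp_inj_on[OF f(1)]] s by simp
    then show ?case using gdist_eq_0_iff s by simp
  next
    case (Suc d)
    have "f u < i" using Suc(3) img by auto
    then have "d \<in> f ` V" unfolding img using Suc(2) by simp
    then obtain v where v: "v \<in> V" "f v = d" by auto
    then have "u \<rightarrow> v" using f(2)[of u v] Suc by simp
    then show ?case using gdist_adj_le[of u v s] s(1) Suc v by fastforce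
  qed
  have eq: "gdist G u s = f u" if "u \<in> V" for u using ge[OF that] le[OF that] by simp
  have "f u < i" if "u \<in> V" for u using that img by auto
  then have "\<forall>u \<in> V. gdist G u s \<le> k" using eq assms(3) by fastforce
  moreover have "inj_on (\<lambda>u. gdist G u s) V"
    using bij_betw_imp_inj_on[OF f(1)] eq by (simp cong: inj_on_cong)
  ultimately show ?thesis using s(1) dist_locating_dominating_singleton_iff by blast
qed

end

theorem theorem3p4:
  fixes G :: "('a, 'b) pre_digraph" and n k :: nat
  assumes "graph G" and "connected G"
    and "card (verts G) = n" and "n \<ge> 2"
    and "k \<ge> 1"
  shows "(location_domination_number k G = 1 \<longleftrightarrow>
           (\<exists>i \<in> {2..k + 1}. digraph_iso G (with_proj (path_graph i)))) \<and>
         (location_domination_number 1 G = n - 1 \<longleftrightarrow>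
           complete_digraph n G \<or> complete_bipartite_digraph 1 (n - 1) G) \<and>
         (k \<ge> 2 \<longrightarrow> (location_domination_number k G = n - 1 \<longleftrightarrow> complete_digraph n G))"
proof -
  interpret connected_graph G
    using assms(1,2) by (simp add: connected_graph_def connected_graph_axioms_def)
  have n: "n = card V" "card V \<ge> 2" using assms(3,4) by simp_all
  have "location_domination_number k G = 1 \<longleftrightarrow>
      (\<exists>i \<in> {2..k + 1}. digraph_iso G (with_proj (path_graph i)))"
    unfolding location_domination_number_eq_1_iff[OF n(2) assms(5)]
  proof
    assume "\<exists>s. dist_locating_dominating G k {s}"
    then show "\<exists>i \<in> {2..k + 1}. digraph_iso G (with_proj (path_graph i))"
      \<comment> \<open>The witness is \<open>i = card V\<close>, which is at least 2 by
        assumption.\<close>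
      using singleton_locating_dominating_imp_path n(2) by fastforce
  next
    assume "\<exists>i \<in> {2..k + 1}. digraph_iso G (with_proj (path_graph i))"
    then show "\<exists>s. dist_locating_dominating G k {s}"
      using path_imp_singleton_locating_dominating by fastforce
  qed
  moreover have "location_domination_number 1 G = n - 1 \<longleftrightarrow>
      complete_digraph n G \<or> complete_bipartite_digraph 1 (n - 1) G"
    unfolding n(1)
    using complete_imp_location_domination_number[OF n(2) order_refl]
      star_imp_location_domination_number[OF n(2)]
      location_domination_number_imp_complete_or_star[OF n(2)] by blast
  moreover have "k \<ge> 2 \<longrightarrow> (location_domination_number k G = n - 1 \<longleftrightarrow> complete_digraph n G)"
    unfolding n(1)
    using complete_imp_location_domination_number[OF n(2) assms(5)]
      location_domination_number_imp_complete[OF n(2)] by blast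
  ultimately show ?thesis by blast
qed

end
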